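(* Let $X\sim\mathcal N(0,\sigma_1^2)$ and $X_T\sim\mathcal N(0,\sigma_2^2)$ be independent, with $\sigma_1,\sigma_2>0$, and fix a clipping range $L>0$. For $Q\in\{1,\dots,8\}$ let $\operatorname{quantize}_Q$ be the $Q$-bit symmetric uniform quantizer on $[-L,L]$: it first clips $x$ to $[-L,L]$ and then rounds to the nearest of the $2^Q$ equally spaced levels $-L+\frac{2Lm}{2^Q-1}$, $m=0,1,\dots,2^Q-1$ (so $\operatorname{quantize}_1(x)=L\operatorname{sign}(x)$). Define the proportion of optimization direction error $$p_{\mathrm{error}}(Q)=P\big(\operatorname{sign}(X-X_T)\neq \operatorname{sign}(\operatorname{quantize}_Q(X)-X_T)\big).$$ Then $p_{\mathrm{error}}(Q)$ becomes larger as $Q$ decreases from $8$ to $1$; that is, $p_{\mathrm{error}}(Q)$ is decreasing in $Q$ on $\{1,\dots,8\}$.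
   Context: $\operatorname{sign}(x)=1$ if $x\ge 0$ and $-1$ otherwise. *)

theory Defs
  imports "HOL-Probability.Probability"
begin

definition sign :: "real \<Rightarrow> real" where
  "sign x = (if x \<ge> 0 then 1 else -1)"

text \<open>Q-bit symmetric uniform quantizer on [-L,L]: clip, then round to the nearest of the
  2^Q levels -L + 2 L m / (2^Q - 1), m = 0..2^Q-1 (ties rounded upward; measure zero).\<close>
definition quantize :: "nat \<Rightarrow> real \<Rightarrow> real \<Rightarrow> real" where
  "quantize Q L x =
     (let c = max (-L) (min L x);
          \<Delta> = 2 * L / (2 ^ Q - 1)
      in -L + \<Delta> * of_int (round ((c + L) / \<Delta>)))"

definition p_error ::
  "'w measure \<Rightarrow> ('w \<Rightarrow> real) \<Rightarrow> ('w \<Rightarrow> real) \<Rightarrow> real \<Rightarrow> nat \<Rightarrow> real" where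
  "p_error M X XT L Q =
     measure M {\<omega> \<in> space M. sign (X \<omega> - XT \<omega>) \<noteq> sign (quantize Q L (X \<omega>) - XT \<omega>)}"

end

theory Submission
  imports Defs "HOL-Real_Asymp.Real_Asymp"
begin

text \<open>
  A centred Gaussian density is a mixture of indicators of symmetric intervals. Tonelli's theorem
  therefore turns the error probability into a mixture, over boxes \<open>[-a, a] \<times> [-b, b]\<close>, of the area
  of the part of the error region inside the box, and it suffices to compare these areas for
  \<open>Q\<close> and \<open>Q + 1\<close> bits. Put \<open>h = L / (2^Q - 1)\<close>. On \<open>[0, L]\<^sup>2\<close> the error region consists of one
  triangular half of each diagonal square of side \<open>h\<close>, above and below the diagonal alternately; outside
  it does not depend on \<open>Q\<close>. For \<open>a, b \<le> L\<close> and \<open>m = min a b\<close> the area in the first quadrant is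
  therefore within \<open>h\<^sup>2 / 8\<close> of \<open>m h / 2\<close>. Passing to \<open>Q + 1\<close> replaces \<open>h\<close> by some \<open>h'\<close> with \<open>h / 3 \<le> h' \<le> h / 2\<close>, so the area
  decreases as soon as \<open>m \<ge> 5 h / 8\<close>; for smaller \<open>m\<close> only the first two squares of
  side \<open>h'\<close> matter.
\<close>

section \<open>The mid-rise staircase and its truncated error\<close>

text \<open>The spacing of the output levels is \<open>2 h\<close>.\<close>

definition midrise :: "real \<Rightarrow> real \<Rightarrow> real" where
  "midrise h x = (2 * of_int \<lfloor>x / (2 * h)\<rfloor> + 1) * h"

text \<open>For \<open>h > 0\<close> and \<open>x\<close>, \<open>b\<close> nonnegative, this is the
  length of the section at \<open>x\<close>, within \<open>|t| \<le> b\<close>, of the region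
  between the diagonal and the graph of \<open>midrise h\<close>.\<close>

definition trunc_err :: "real \<Rightarrow> real \<Rightarrow> real \<Rightarrow> real" where
  "trunc_err h b x = \<bar>min x b - min (midrise h x) b\<bar>"

text \<open>The levels are the odd multiples of \<open>h\<close>, so each cell of width
  \<open>h\<close> has exactly one endpoint that is a level: the right one for even
  \<open>j\<close>, the left one for odd \<open>j\<close>. Hence the triangles alternate between the
  two sides of the diagonal.\<close>

lemma midrise_cell:
  assumes "h > 0" "real j * h \<le> x" "x < (real j + 1) * h"
  shows "midrise h x = (if even j then real j + 1 else real j) * h"
proof (cases "even j")
  case True
  then obtain k where k: "j = 2 * k" by (elim evenE)
  have "\<lfloor>x / (2 * h)\<rfloor> = int k"
    using assms by (intro floor_unique) (auto simp: k field_simps)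
  then show ?thesis using True by (simp add: midrise_def k)
next
  case False
  then obtain k where k: "j = 2 * k + 1" by (elim oddE)
  have "\<lfloor>x / (2 * h)\<rfloor> = int k"
    using assms by (intro floor_unique) (auto simp: k field_simps)
  then show ?thesis using False by (simp add: midrise_def k)
qed

lemma midrise_mono: "h > 0 \<Longrightarrow> x \<le> y \<Longrightarrow> midrise h x \<le> midrise h y"
  unfolding midrise_def by (intro mult_right_mono) (auto intro!: floor_mono divide_right_mono)

lemma midrise_ge: "h > 0 \<Longrightarrow> 0 \<le> x \<Longrightarrow> h \<le> midrise h x"
  using midrise_mono[of h 0 x] by (simp add: midrise_def)

lemma midrise_dist: 
  assumes "h > 0" shows "\<bar>x - midrise h x\<bar> \<le> h"
proof -
  have "of_int \<lfloor>x / (2 * h)\<rfloor> * (2 * h) \<le> x" "x < (of_int \<lfloor>x / (2 * h)\<rfloor> + 1) * (2 * h)"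
    using assms by (auto intro: floor_divide_lower floor_divide_upper)
  then show ?thesis by (auto simp: midrise_def algebra_simps abs_le_iff)
qed

lemma borel_measurable_midrise [measurable]: "midrise h \<in> borel_measurable borel"
  unfolding midrise_def by measurable

lemma borel_measurable_trunc_err [measurable]: "trunc_err h b \<in> borel_measurable borel"
  unfolding trunc_err_def by measurable

lemma trunc_err_nonneg: "0 \<le> trunc_err h b x"
  by (simp add: trunc_err_def)

lemma trunc_err_le: "trunc_err h b x \<le> \<bar>x - midrise h x\<bar>"
  by (auto simp: trunc_err_def)

lemma trunc_err_mono: "b \<le> c \<Longrightarrow> trunc_err h b x \<le> trunc_err h c x"
  by (auto simp: trunc_err_def)

lemma trunc_err_integrable:
  assumes "h > 0" shows "set_integrable lborel {c..d} (trunc_err h b)"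
proof -
  have "\<bar>trunc_err h b x\<bar> \<le> h" for x
    using trunc_err_le[of h b x] midrise_dist[OF assms, of x] trunc_err_nonneg[of h b x] by linarith
  then show ?thesis unfolding set_integrable_def
    by (intro integrableI_bounded_set_indicator[where B=h]) (auto simp: emeasure_lborel_Icc_eq)
qed

lemma trunc_err_integrable_on: "h > 0 \<Longrightarrow> trunc_err h b integrable_on {c..d}"
  using set_borel_integral_eq_integral(1)[OF trunc_err_integrable] .

section \<open>Exact areas of the triangles over whole and partial cells\<close>

lemma has_integral_dist_left:
  fixes c d y :: real assumes "c \<le> d" "y \<le> c"
  shows "((\<lambda>x. \<bar>x - y\<bar>) has_integral (d - y)\<^sup>2 / 2 - (c - y)\<^sup>2 / 2) {c..d}"
proof -
  have "((\<lambda>x. x - y) has_integral (d - y)\<^sup>2 / 2 - (c - y)\<^sup>2 / 2) {c..d}"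
    using assms by (intro fundamental_theorem_of_calculus)
      (auto intro!: derivative_eq_intros simp flip: has_real_derivative_iff_has_vector_derivative)
  then show ?thesis by (rule has_integral_eq[rotated]) (use assms in auto)
qed

lemma has_integral_dist_right:
  fixes c d y :: real assumes "c \<le> d" "d \<le> y"
  shows "((\<lambda>x. \<bar>x - y\<bar>) has_integral (y - c)\<^sup>2 / 2 - (y - d)\<^sup>2 / 2) {c..d}"
proof -
  have "((\<lambda>x. y - x) has_integral (- (y - d)\<^sup>2 / 2) - (- (y - c)\<^sup>2 / 2)) {c..d}"
    using assms by (intro fundamental_theorem_of_calculus)
      (auto intro!: derivative_eq_intros simp: field_simps
        simp flip: has_real_derivative_iff_has_vector_derivative)
  then have "((\<lambda>x. y - x) has_integral (y - c)\<^sup>2 / 2 - (y - d)\<^sup>2 / 2) {c..d}" by simp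
  then show ?thesis by (rule has_integral_eq[rotated]) (use assms in auto)
qed

lemma has_integral_partial_cell:
  assumes h: "h > 0" and a: "real j * h \<le> a" "a \<le> (real j + 1) * h"
  defines "u \<equiv> a - real j * h"
  shows "((\<lambda>x. \<bar>x - midrise h x\<bar>) has_integral (if even j then u * h - u\<^sup>2 / 2 else u\<^sup>2 / 2))
    {real j * h..a}"
proof -
  let ?y = "(if even j then real j + 1 else real j) * h"
  have "((\<lambda>x. \<bar>x - ?y\<bar>) has_integral (if even j then u * h - u\<^sup>2 / 2 else u\<^sup>2 / 2)) {real j * h..a}"
  proof (cases "even j")
    case True
    then show ?thesis using has_integral_dist_right[of "real j * h" a ?y] a
      by (simp add: u_def algebra_simps power2_eq_square add_divide_distrib diff_divide_distrib)
  next
    case False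
    then show ?thesis using has_integral_dist_left[of "real j * h" a ?y] a
      by (simp add: u_def)
  qed
  then show ?thesis
    \<comment> \<open>The point \<open>a\<close> is dropped because it may be the right end of the
      cell, where \<open>midrise h\<close> jumps if \<open>j\<close> is odd.\<close>
    by (rule has_integral_spike_finite[of "{a}", rotated 2])
       (use a midrise_cell[OF h, of j] in auto)
qed

text \<open>Whichever half of its square a cell cuts out, the area is
  \<open>h^2 / 2\<close>.\<close>

lemma has_integral_cells:
  assumes "h > 0"
  shows "((\<lambda>x. \<bar>x - midrise h x\<bar>) has_integral real j * h\<^sup>2 / 2) {0..real j * h}"
proof (induction j)
  case 0
  then show ?case by (simp add: has_integral_refl)
next
  case (Suc j)
  have "((\<lambda>x. \<bar>x - midrise h x\<bar>) has_integral h\<^sup>2 / 2) {real j * h..(real j + 1) * h}"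
    using has_integral_partial_cell[OF assms, of j "(real j + 1) * h"] assms
    by (auto simp: algebra_simps power2_eq_square split: if_splits)
  from has_integral_combine[OF _ _ Suc this] show ?case using assms
    by (simp add: algebra_simps add_divide_distrib)
qed

section \<open>Two-sided bounds for the error area in a quadrant box\<close>

text \<open>Shrinking the box to the square of side \<open>m\<close> only loses area. That square
  contains \<open>j\<close> full triangles and, in its last corner, one triangle with legs
  \<open>m - j * h\<close>.\<close>

lemma integral_trunc_err_ge:
  assumes h: "h > 0" and m: "real j * h \<le> m" "m \<le> (real j + 1) * h" and "m \<le> a" "m \<le> b"
  shows "real j * h\<^sup>2 / 2 + (m - real j * h)\<^sup>2 / 2 \<le> integral {0..a} (trunc_err h b)"
proof -
  let ?f = "trunc_err h m"
  have jh: "0 \<le> real j * h" using h by simp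
  \<comment> \<open>On a cell with index \<open>i < j\<close> the level is at most
    \<open>(i + 1) * h \<le> j * h \<le> m\<close>, so truncation at \<open>m\<close> changes
    nothing.\<close>
  have "(?f has_integral real j * h\<^sup>2 / 2) {0..real j * h}"
  proof (rule has_integral_spike_finite[OF _ _ has_integral_cells[OF h]])
    fix x assume x: "x \<in> {0..real j * h} - {real j * h}"
    define i where "i = nat \<lfloor>x / h\<rfloor>"
    have i: "real i * h \<le> x" "x < (real i + 1) * h"
      using x h floor_divide_lower[OF h, of x] floor_divide_upper[OF h, of x] by (auto simp: i_def)
    have "real i * h < real j * h" using i x by auto
    then have "i < j" using h by simp
    then have "(real i + 1) * h \<le> real j * h" using h by (intro mult_right_mono) auto
    moreover have "midrise h x \<le> (real i + 1) * h"
      unfolding midrise_cell[OF h i] using h by (intro mult_right_mono) auto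
    ultimately show "?f x = \<bar>x - midrise h x\<bar>"
      using x m by (auto simp: trunc_err_def)
  qed auto
  \<comment> \<open>In the last cell the level is \<open>(j + 1) * h\<close>, truncated to
    \<open>m\<close>, for even \<open>j\<close>, and \<open>j * h\<close> for odd \<open>j\<close>.
    Both give a triangle with legs \<open>m - j * h\<close>.\<close>
  moreover have "(?f has_integral (m - real j * h)\<^sup>2 / 2) {real j * h..m}"
  proof (cases "even j")
    case True
    have "((\<lambda>x. \<bar>x - m\<bar>) has_integral (m - real j * h)\<^sup>2 / 2) {real j * h..m}"
      using has_integral_dist_right[of "real j * h" m m] m by simp
    then show ?thesis
    proof (rule has_integral_spike_finite[of "{m}", rotated 2])
      fix x assume x: "x \<in> {real j * h..m} - {m}"
      then have "midrise h x = (real j + 1) * h" using midrise_cell[OF h, of j x] m True by auto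
      then show "?f x = \<bar>x - m\<bar>" using x m by (auto simp: trunc_err_def)
    qed auto
  next
    case False
    have "((\<lambda>x. \<bar>x - real j * h\<bar>) has_integral (m - real j * h)\<^sup>2 / 2) {real j * h..m}"
      using has_integral_dist_left[of "real j * h" m "real j * h"] m by simp
    then show ?thesis
    proof (rule has_integral_spike_finite[of "{m}", rotated 2])
      fix x assume x: "x \<in> {real j * h..m} - {m}"
      then have "midrise h x = real j * h" using midrise_cell[OF h, of j x] m False by auto
      then show "?f x = \<bar>x - real j * h\<bar>" using x m by (auto simp: trunc_err_def)
    qed auto
  qed
  ultimately have "(?f has_integral real j * h\<^sup>2 / 2 + (m - real j * h)\<^sup>2 / 2) {0..m}"
    using has_integral_combine[of 0 "real j * h" m ?f] jh m by blast
  then have "real j * h\<^sup>2 / 2 + (m - real j * h)\<^sup>2 / 2 = integral {0..m} ?f" by (simp add: integral_unique)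
  also have "\<dots> \<le> integral {0..m} (trunc_err h b)"
    using trunc_err_integrable_on[OF h] trunc_err_mono[OF \<open>m \<le> b\<close>] by (intro integral_le) auto
  also have "\<dots> \<le> integral {0..a} (trunc_err h b)"
    using trunc_err_integrable_on[OF h] trunc_err_nonneg \<open>m \<le> a\<close> by (intro integral_subset_le) auto
  finally show ?thesis .
qed

text \<open>Beyond the \<open>j\<close> full triangles, one side of the box cuts the next one. At
  worst this leaves the trapezoid obtained by removing a corner with legs \<open>h - u\<close>, of
  area \<open>h^2 / 2 - (h - u)^2 / 2 = u * h - u^2 / 2\<close>; otherwise it leaves a triangle with
  legs \<open>u\<close>.\<close>

lemma integral_trunc_err_le:
  assumes h: "h > 0" and m: "real j * h \<le> m" "m \<le> (real j + 1) * h" and "m = min a b"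
  defines "u \<equiv> m - real j * h"
  shows "integral {0..a} (trunc_err h b) \<le> real j * h\<^sup>2 / 2 + (u * h - u\<^sup>2 / 2)"
proof -
  have jh: "0 \<le> real j * h" using h by simp
  have u: "0 \<le> u" "u \<le> h" using m by (auto simp: u_def algebra_simps)
  have uu: "u\<^sup>2 / 2 \<le> u * h - u\<^sup>2 / 2" using u by (simp add: power2_eq_square mult_left_mono)
  show ?thesis
  proof (cases "a \<le> b")
    case True
    then have ma: "m = a" using assms by simp
    have *: "((\<lambda>x. \<bar>x - midrise h x\<bar>) has_integral (real j * h\<^sup>2 / 2 + (if even j then u * h - u\<^sup>2 / 2 else u\<^sup>2 / 2))) {0..a}"
      using has_integral_combine[OF _ _ has_integral_cells[OF h, of j] has_integral_partial_cell[OF h, of j a]]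
        jh m unfolding u_def ma by simp
    have "integral {0..a} (trunc_err h b) \<le> integral {0..a} (\<lambda>x. \<bar>x - midrise h x\<bar>)"
      using * trunc_err_integrable_on[OF h] trunc_err_le by (intro integral_le) auto
    also have "\<dots> \<le> real j * h\<^sup>2 / 2 + (u * h - u\<^sup>2 / 2)"
      using integral_unique[OF *] uu by auto
    finally show ?thesis .
  next
    case False
    then have mb: "m = b" using assms by simp
    \<comment> \<open>Extending the range of \<open>x\<close> to the end of the cell containing
      \<open>b\<close> only adds area and spares a case distinction on where \<open>a\<close>
      lies.\<close>
    define A where "A = max a ((real j + 1) * h)"
    have A: "a \<le> A" "(real j + 1) * h \<le> A" "b \<le> A" using m mb by (auto simp: A_def)
    have jA: "real j * h \<le> A" using A m mb by linarith
    have "integral {0..a} (trunc_err h b) \<le> integral {0..A} (trunc_err h b)"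
      using trunc_err_integrable_on[OF h] trunc_err_nonneg A by (intro integral_subset_le) auto
    also have "\<dots> = integral {0..real j * h} (trunc_err h b) + integral {real j * h..A} (trunc_err h b)"
      using jh jA trunc_err_integrable_on[OF h]
      by (intro Henstock_Kurzweil_Integration.integral_combine[symmetric]) auto
    also have "integral {0..real j * h} (trunc_err h b) \<le> integral {0..real j * h} (\<lambda>x. \<bar>x - midrise h x\<bar>)"
      using has_integral_cells[OF h, of j] trunc_err_integrable_on[OF h] trunc_err_le
      by (intro integral_le) auto
    also have "\<dots> = real j * h\<^sup>2 / 2" using has_integral_cells[OF h, of j] by (rule integral_unique)
    also have "integral {real j * h..A} (trunc_err h b) \<le> u * h - u\<^sup>2 / 2"
    proof (cases "even j")
      case True
      have "(trunc_err h b has_integral u\<^sup>2 / 2) {real j * h..b}"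
      proof -
        have "((\<lambda>x. \<bar>x - b\<bar>) has_integral u\<^sup>2 / 2) {real j * h..b}"
          using has_integral_dist_right[of "real j * h" b b] m by (simp add: u_def mb)
        then show ?thesis
        proof (rule has_integral_spike_finite[of "{b}", rotated 2])
          fix x assume x: "x \<in> {real j * h..b} - {b}"
          then have "midrise h x = (real j + 1) * h" using midrise_cell[OF h, of j x] m mb True by auto
          then show "trunc_err h b x = \<bar>x - b\<bar>" using x m mb by (auto simp: trunc_err_def)
        qed auto
      qed
      \<comment> \<open>From \<open>b\<close> on, the level is at least
        \<open>(j + 1) * h \<ge> b\<close>, so \<open>x\<close> and its level are both truncated to
        \<open>b\<close>.\<close>
      moreover have "(trunc_err h b has_integral 0) {b..A}"
      proof (rule has_integral_is_0)
        fix x assume x: "x \<in> {b..A}"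
        have "midrise h (real j * h) = (real j + 1) * h" using midrise_cell[OF h, of j "real j * h"] h True by simp
        moreover have "midrise h (real j * h) \<le> midrise h x" using x m mb by (intro midrise_mono h) auto
        ultimately show "trunc_err h b x = 0" using x m mb by (auto simp: trunc_err_def)
      qed
      ultimately have "(trunc_err h b has_integral u\<^sup>2 / 2) {real j * h..A}"
        using has_integral_combine[of "real j * h" b A "trunc_err h b"] m mb A by fastforce
      then show ?thesis using uu by (auto simp: integral_unique)
    next
      case False
      let ?c = "(real j + 1) * h"
      have mid: "midrise h x = real j * h" if "x \<in> {real j * h..<?c}" for x
        using midrise_cell[OF h, of j x] that False by auto
      have "(trunc_err h b has_integral u\<^sup>2 / 2) {real j * h..b}"
      proof -
        have "((\<lambda>x. \<bar>x - real j * h\<bar>) has_integral u\<^sup>2 / 2) {real j * h..b}"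
          using has_integral_dist_left[of "real j * h" b "real j * h"] m by (simp add: u_def mb)
        then show ?thesis
        proof (rule has_integral_spike_finite[of "{b}", rotated 2])
          fix x assume x: "x \<in> {real j * h..b} - {b}"
          then show "trunc_err h b x = \<bar>x - real j * h\<bar>" using mid[of x] x m mb by (auto simp: trunc_err_def)
        qed auto
      qed
      \<comment> \<open>Here \<open>x\<close> is truncated to \<open>b\<close> while the level is
        still \<open>j * h\<close>: a rectangle of height \<open>u\<close>. It turns the triangle
        into the trapezoid; past the cell the level exceeds \<open>b\<close>.\<close>
      moreover have "(trunc_err h b has_integral (?c - b) * u) {b..?c}"
      proof -
        have "((\<lambda>x. u) has_integral (?c - b) * u) {b..?c}"
          using has_integral_const_real[of u b ?c] m mb by simp
        then show ?thesis
        proof (rule has_integral_spike_finite[of "{?c}", rotated 2])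
          fix x assume x: "x \<in> {b..?c} - {?c}"
          then show "trunc_err h b x = u" using mid[of x] x m mb by (auto simp: trunc_err_def u_def)
        qed auto
      qed
      moreover have "(trunc_err h b has_integral 0) {?c..A}"
      proof (rule has_integral_is_0)
        fix x assume x: "x \<in> {?c..A}"
        have "midrise h ?c = (real j + 2) * h" using midrise_cell[OF h, of "Suc j" ?c] h False by (simp add: algebra_simps)
        moreover have "midrise h ?c \<le> midrise h x" using x m mb by (intro midrise_mono h) auto
        moreover have "b \<le> (real j + 2) * h" using m mb h by (simp add: algebra_simps)
        ultimately show "trunc_err h b x = 0" using x m mb by (auto simp: trunc_err_def)
      qed
      ultimately have "(trunc_err h b has_integral u\<^sup>2 / 2 + ((?c - b) * u + 0)) {real j * h..A}"
        using has_integral_combine[of b ?c A "trunc_err h b"]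
          has_integral_combine[of "real j * h" b A "trunc_err h b"] m mb A by blast
      then have "integral {real j * h..A} (trunc_err h b) = u\<^sup>2 / 2 + (?c - b) * u"
        by (simp add: integral_unique)
      also have "\<dots> = u * h - u\<^sup>2 / 2"
        by (simp add: u_def mb field_simps power2_eq_square)
      finally show ?thesis by simp
    qed
    finally show ?thesis by simp
  qed
qed

lemma obtain_cell:
  fixes h m :: real assumes "h > 0" "0 \<le> m"
  obtains j :: nat where "real j * h \<le> m" "m \<le> (real j + 1) * h"
proof
  show "real (nat \<lfloor>m / h\<rfloor>) * h \<le> m" "m \<le> (real (nat \<lfloor>m / h\<rfloor>) + 1) * h"
    using assms floor_divide_lower[of h m] floor_divide_upper[of h m] by auto
qed

lemma integral_trunc_err_linear_bounds:
  assumes h: "h > 0" and "0 \<le> a" "0 \<le> b"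
  shows "min a b * h / 2 - h\<^sup>2 / 8 \<le> integral {0..a} (trunc_err h b)"
    and "integral {0..a} (trunc_err h b) \<le> min a b * h / 2 + h\<^sup>2 / 8"
proof -
  define m where "m = min a b"
  have "0 \<le> m" using assms by (simp add: m_def)
  with h obtain j where j: "real j * h \<le> m" "m \<le> (real j + 1) * h" by (rule obtain_cell)
  define u where "u = m - real j * h"
  \<comment> \<open>Both exact bounds differ from \<open>m * h / 2\<close> by
    \<open>(u * h - u^2) / 2\<close>, and this square being nonnegative says that the difference is
    at most \<open>h^2 / 8\<close>.\<close>
  have sq: "0 \<le> (u - h / 2)\<^sup>2 / 2" by simp
  have m: "m = real j * h + u" by (simp add: u_def)
  have "m * h / 2 - h\<^sup>2 / 8 \<le> real j * h\<^sup>2 / 2 + u\<^sup>2 / 2"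
    using sq by (simp add: m power2_eq_square field_simps)
  then show "min a b * h / 2 - h\<^sup>2 / 8 \<le> integral {0..a} (trunc_err h b)"
    using integral_trunc_err_ge[OF h j, of a b] unfolding u_def m_def by simp
  have "real j * h\<^sup>2 / 2 + (u * h - u\<^sup>2 / 2) \<le> m * h / 2 + h\<^sup>2 / 8"
    using sq by (simp add: m power2_eq_square field_simps)
  then show "integral {0..a} (trunc_err h b) \<le> min a b * h / 2 + h\<^sup>2 / 8"
    using integral_trunc_err_le[OF h j m_def] unfolding u_def m_def by simp
qed

section \<open>Comparison of two successive resolutions\<close>

text \<open>The main terms differ by at least \<open>min a b * h / 4\<close>, and the two deviations
  cost at most \<open>h^2 / 8 + h'^2 / 8 \<le> 5 * h^2 / 32\<close>. The gap is kept explicit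
  because it later yields strictness.\<close>

lemma integral_trunc_err_refine_gap:
  assumes h: "h > 0" "0 < h'" "h' \<le> h / 2" and ab: "0 \<le> a" "0 \<le> b"
  shows "integral {0..a} (trunc_err h' b) + h * (min a b / 4 - 5 * h / 32)
    \<le> integral {0..a} (trunc_err h b)"
proof -
  have "min a b * h' \<le> min a b * (h / 2)" using ab h by (intro mult_left_mono) auto
  moreover have "h'\<^sup>2 \<le> (h / 2)\<^sup>2" using h by (intro power_mono) auto
  moreover have "(h / 2)\<^sup>2 = h\<^sup>2 / 4" "h * (min a b / 4 - 5 * h / 32) = min a b * h / 4 - 5 * h\<^sup>2 / 32"
    by (simp_all add: power2_eq_square algebra_simps)
  ultimately show ?thesis
    using integral_trunc_err_linear_bounds(1)[OF h(1) ab] integral_trunc_err_linear_bounds(2)[OF h(2) ab]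
    by simp
qed

lemma integral_trunc_err_refine:
  assumes h: "h > 0" "h / 3 \<le> h'" "h' \<le> h / 2" and ab: "0 \<le> a" "0 \<le> b"
  shows "integral {0..a} (trunc_err h' b) \<le> integral {0..a} (trunc_err h b)"
proof -
  define m where "m = min a b"
  have h': "0 < h'" "h' \<le> h" using h by auto
  have m: "0 \<le> m" "m \<le> a" "m \<le> b" using ab by (auto simp: m_def)
  \<comment> \<open>The value \<open>5 * h / 8\<close> is where the explicit gap becomes
    nonnegative. Below it, \<open>m < h\<close> and \<open>m < 2 * h'\<close>, since
    \<open>2 * h' \<ge> 2 * h / 3\<close>.\<close>
  consider "m < h'" | "h' \<le> m" "m < 5 * h / 8" | "5 * h / 8 \<le> m" by linarith
  then show ?thesis
  proof cases
    case 1
    \<comment> \<open>Pointwise comparison: if \<open>b < h'\<close>, both levels are truncated to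
      \<open>b\<close>; otherwise \<open>x \<le> a < h'\<close>, and the levels \<open>h'\<close>
      and \<open>h\<close> both lie above \<open>x\<close>, the coarser one farther away.\<close>
    have "trunc_err h' b x \<le> trunc_err h b x" if x: "x \<in> {0..a}" for x
    proof (cases "b < h'")
      case True
      then show ?thesis using midrise_ge[OF h(1), of x] midrise_ge[OF h'(1), of x] x h'
        by (auto simp: trunc_err_def)
    next
      case False
      then have "x < h'" using 1 x by (auto simp: m_def split: if_splits)
      then have "midrise h' x = h'" "midrise h x = h"
        using midrise_cell[OF h'(1), of 0 x] midrise_cell[OF h(1), of 0 x] h' x by auto
      then show ?thesis using \<open>x < h'\<close> h' by (auto simp: trunc_err_def)
    qed
    then show ?thesis using trunc_err_integrable_on h(1) h'(1) by (intro integral_le) auto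
  next
    case 2
    define w where "w = m - h'"
    have "integral {0..a} (trunc_err h' b) \<le> h'\<^sup>2 / 2 + (w * h' - w\<^sup>2 / 2)"
      using integral_trunc_err_le[OF h'(1) _ _ m_def, of 1] 2 h by (simp add: w_def)
    \<comment> \<open>With \<open>m = h' + w\<close> the two sides differ by \<open>w^2\<close>. The
      value \<open>m^2 / 2\<close> is exactly the lower bound for \<open>h\<close> with no full
      cell.\<close>
    also have "\<dots> \<le> m\<^sup>2 / 2"
    proof -
      have "m = h' + w" by (simp add: w_def)
      then show ?thesis by (simp add: power2_eq_square field_simps)
    qed
    also have "\<dots> \<le> integral {0..a} (trunc_err h b)"
      using integral_trunc_err_ge[OF h(1) _ _ m(2,3), of 0] 2 m h by simp
    finally show ?thesis .
  next
    case 3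
    then have "0 \<le> h * (min a b / 4 - 5 * h / 32)" using h by (auto simp: m_def)
    then show ?thesis using integral_trunc_err_refine_gap[OF h(1) h'(1) h(3) ab] by linarith
  qed
qed

section \<open>The quantizer as a staircase, its sections and its symmetry\<close>

text \<open>Since \<open>L\<close> is the odd multiple \<open>2 ^ Q - 1\<close> of \<open>h\<close>,
  the offset \<open>L / (2 * h)\<close> and the \<open>1 / 2\<close> from rounding add up to the
  integer \<open>2 ^ (Q - 1)\<close>, which can be pulled out of the floor.\<close>

lemma quantize_eq_midrise:
  assumes "L > 0" "1 \<le> Q"
  shows "quantize Q L x = midrise (L / (2 ^ Q - 1)) (max (- L) (min L x))"
proof -
  define c where "c = max (- L) (min L x)"
  define h where "h = L / (2 ^ Q - 1)"
  obtain n where n: "Q = Suc n" using assms(2) by (cases Q) auto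
  have N: "(2::real) ^ Q - 1 > 0" using assms(2) by simp
  have h: "h > 0" using assms N by (simp add: h_def)
  have L: "L = (2 * 2 ^ n - 1) * h" using N by (simp add: h_def n)
  have "(c + L) / (2 * h) + 1 / 2 = c / (2 * h) + 2 ^ n"
    using h by (simp add: L field_simps)
  then have "round ((c + L) / (2 * h)) = \<lfloor>c / (2 * h) + of_int (2 ^ n)\<rfloor>"
    by (simp add: round_def)
  then have "round ((c + L) / (2 * h)) = \<lfloor>c / (2 * h)\<rfloor> + 2 ^ n"
    by (simp only: floor_add_int)
  then have "- L + 2 * h * of_int (round ((c + L) / (2 * h))) = midrise h c"
    by (simp add: midrise_def L algebra_simps)
  then show ?thesis
    by (simp add: quantize_def Let_def flip: c_def h_def)
       (simp add: h_def)
qed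

lemma borel_measurable_quantize [measurable]: "quantize Q L \<in> borel_measurable borel"
  unfolding quantize_def Let_def round_def by measurable

lemma borel_measurable_sign [measurable]: "sign \<in> borel_measurable borel"
  unfolding sign_def by measurable

definition clip :: "real \<Rightarrow> real \<Rightarrow> real" where
  "clip b x = max (- b) (min b x)"

text \<open>The signs differ exactly for \<open>t\<close> in the half-open interval between
  \<open>x\<close> and \<open>y\<close>. After clipping, the left end \<open>-b\<close> may belong
  to the set, hence the sandwich between \<open>{lo<..hi}\<close> and
  \<open>{lo..hi}\<close>.\<close>

lemma emeasure_sign_change:
  assumes "0 \<le> b"
  shows "emeasure lborel {t. \<bar>t\<bar> \<le> b \<and> sign (x - t) \<noteq> sign (y - t)} = ennreal \<bar>clip b x - clip b y\<bar>"
    (is "emeasure _ ?S = _")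
proof -
  define lo hi where "lo = clip b (min x y)" and "hi = clip b (max x y)"
  have "lo \<le> hi" by (auto simp: lo_def hi_def clip_def)
  have S: "?S \<in> sets lborel" by measurable
  have "emeasure lborel ?S \<le> emeasure lborel {lo..hi}"
    by (intro emeasure_mono) (auto simp: lo_def hi_def clip_def sign_def split: if_splits)
  moreover have "emeasure lborel {lo<..hi} \<le> emeasure lborel ?S"
    by (intro emeasure_mono S) (use assms in \<open>auto simp: lo_def hi_def clip_def sign_def max_def min_def split: if_splits\<close>)
  ultimately have "emeasure lborel ?S = ennreal (hi - lo)"
    using \<open>lo \<le> hi\<close> by simp
  also have "hi - lo = \<bar>clip b x - clip b y\<bar>"
    by (cases "x \<le> y") (auto simp: lo_def hi_def clip_def)
  finally show ?thesis .
qed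

text \<open>Oddness can fail only at the jumps, the even multiples of \<open>h\<close>, where ties
  go upward; elsewhere ceiling and floor differ by one. The exceptional set is countable, so oddness
  holds almost everywhere.\<close>

lemma midrise_minus:
  assumes "x / (2 * h) \<notin> \<int>"
  shows "midrise h (- x) = - midrise h x"
proof -
  have "\<lfloor>- (x / (2 * h))\<rfloor> = - \<lceil>x / (2 * h)\<rceil>" by (simp add: ceiling_def)
  also have "\<lceil>x / (2 * h)\<rceil> = \<lfloor>x / (2 * h)\<rfloor> + 1" using assms by (simp add: ceiling_altdef Ints_def) (metis rangeI)
  finally have "\<lfloor>- x / (2 * h)\<rfloor> = - \<lfloor>x / (2 * h)\<rfloor> - 1" by simp
  then show ?thesis unfolding midrise_def by (simp only:) (simp add: algebra_simps)
qed

lemma AE_midrise_minus: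
  assumes "h > 0" 
  shows "AE x in lborel. midrise h (- x) = - midrise h x"
proof -
  have "{x. x / (2 * h) \<in> \<int>} \<subseteq> (\<lambda>k. 2 * h * of_int k) ` (UNIV :: int set)"
    using assms by (auto elim!: Ints_cases simp: field_simps)
  then have "countable {x. x / (2 * h) \<in> \<int>}" by (rule countable_subset) auto
  then have "{x. x / (2 * h) \<in> \<int>} \<in> null_sets lborel" by (rule countable_imp_null_set_lborel)
  then have "AE x in lborel. x \<notin> {x. x / (2 * h) \<in> \<int>}" by (rule AE_not_in)
  then show ?thesis by eventually_elim (auto intro: midrise_minus)
qed

lemma nn_integral_symmetric:
  fixes g :: "real \<Rightarrow> ennreal"
  assumes [measurable]: "g \<in> borel_measurable borel" and even: "AE x in lborel. g (- x) = g x"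
  shows "(\<integral>\<^sup>+x. g x * indicator {-a..a} x \<partial>lborel) = 2 * (\<integral>\<^sup>+x. g x * indicator {0..a} x \<partial>lborel)"
proof -
  have "(\<integral>\<^sup>+x. g x * indicator {-a..a} x \<partial>lborel) =
      (\<integral>\<^sup>+x. g x * indicator {-a..<0} x + g x * indicator {0..a} x \<partial>lborel)"
    by (intro nn_integral_cong) (auto split: split_indicator)
  also have "\<dots> = (\<integral>\<^sup>+x. g x * indicator {-a..<0} x \<partial>lborel) + (\<integral>\<^sup>+x. g x * indicator {0..a} x \<partial>lborel)"
    by (intro nn_integral_add) auto
  also have "(\<integral>\<^sup>+x. g x * indicator {-a..<0} x \<partial>lborel) = (\<integral>\<^sup>+x. g (- x) * indicator {-a..<0} (- x) \<partial>lborel)"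
    using nn_integral_real_affine[of "\<lambda>x. g x * indicator {-a..<0} x" "-1" 0] by simp
  also have "\<dots> = (\<integral>\<^sup>+x. g x * indicator {0..a} x \<partial>lborel)"
  \<comment> \<open>Reflecting \<open>{-a..<0}\<close> gives \<open>{0<..a}\<close>, so the point
    \<open>0\<close> has to be ignored as well.\<close>
  proof (rule nn_integral_cong_AE)
    show "AE x in lborel. g (- x) * indicator {- a..<0} (- x) = g x * indicator {0..a} x"
      using even AE_lborel_singleton[of 0] by eventually_elim (auto split: split_indicator)
  qed
  finally show ?thesis by (simp add: mult_2)
qed

section \<open>Areas of the error region in symmetric boxes\<close>

definition sign_error :: "nat \<Rightarrow> real \<Rightarrow> (real \<times> real) set" where
  "sign_error Q L = {(x, t). sign (x - t) \<noteq> sign (quantize Q L x - t)}"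

text \<open>The indicators are written as functions of \<open>a\<close> and \<open>b\<close> to match the layer-cake formula.\<close>
definition box_area :: "nat \<Rightarrow> real \<Rightarrow> real \<Rightarrow> real \<Rightarrow> ennreal" where
  "box_area Q L a b = (\<integral>\<^sup>+x. \<integral>\<^sup>+t. indicator {\<bar>x\<bar>..} a * indicator {\<bar>t\<bar>..} b
     * indicator (sign_error Q L) (x, t) \<partial>lborel \<partial>lborel)"

lemma sign_error_measurable [measurable]: "sign_error Q L \<in> sets (borel \<Otimes>\<^sub>M borel)"
proof -
  have "{p \<in> space (borel \<Otimes>\<^sub>M borel). sign (fst p - snd p) \<noteq> sign (quantize Q L (fst p) - snd p)}
      \<in> sets (borel \<Otimes>\<^sub>M borel)"
    by measurable
  also have "{p \<in> space (borel \<Otimes>\<^sub>M borel). sign (fst p - snd p) \<noteq> sign (quantize Q L (fst p) - snd p)}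
      = sign_error Q L"
    by (auto simp: sign_error_def space_pair_measure)
  finally show ?thesis .
qed

lemma abs_le_indicator_measurable [measurable]:
  "(\<lambda>(x, a). indicator {\<bar>x\<bar>..} a :: ennreal) \<in> borel_measurable (borel \<Otimes>\<^sub>M (borel :: real measure))"
proof -
  have "(\<lambda>(x :: real, a). indicator {\<bar>x\<bar>..} a) = (\<lambda>p. if \<bar>fst p\<bar> \<le> snd p then 1 else 0 :: ennreal)"
    by (auto split: split_indicator)
  moreover have "(\<lambda>p. if \<bar>fst p\<bar> \<le> snd p then 1 else 0 :: ennreal)
      \<in> borel_measurable (borel \<Otimes>\<^sub>M (borel :: real measure))" by measurable
  ultimately show ?thesis by simp
qed

lemma midrise_odd_multiple:
  assumes "h \<noteq> 0"
  shows "midrise h ((2 * of_int k + 1) * h) = (2 * of_int k + 1) * h"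
proof -
  have "(2 * of_int k + 1) * h / (2 * h) = of_int k + 1 / 2"
    using assms by (simp add: field_simps)
  then have "\<lfloor>(2 * of_int k + 1) * h / (2 * h)\<rfloor> = k"
    by (simp only:) (intro floor_unique; simp)
  then show ?thesis unfolding midrise_def by simp
qed

text \<open>Integrate the section lengths over \<open>x\<close> and fold by symmetry onto
  \<open>x \<ge> 0\<close>. Up to \<open>L\<close> the section is the truncated staircase error;
  beyond \<open>L\<close> the output is constantly \<open>L\<close>, so the second summand is
  independent of \<open>Q\<close>.\<close>

lemma box_area_eq:
  assumes L: "L > 0" and Q: "1 \<le> Q" and ab: "0 \<le> a" "0 \<le> b"
  shows "box_area Q L a b =
    2 * (ennreal (integral {0..min a L} (trunc_err (L / (2 ^ Q - 1)) (min b L)))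
      + (\<integral>\<^sup>+x. ennreal \<bar>min x b - min L b\<bar> * indicator {L<..a} x \<partial>lborel))"
proof -
  define h where "h = L / (2 ^ Q - 1)"
  have N: "(2::real) ^ Q - 1 > 0" using Q by simp
  have h: "h > 0" using L N by (simp add: h_def)
  have q: "quantize Q L x = midrise h (clip L x)" for x
    using quantize_eq_midrise[OF L Q] by (simp add: h_def clip_def)
  have midL: "midrise h L = L" "midrise h (- L) = - L"
  proof -
    obtain n where n: "Q = Suc n" using Q by (cases Q) auto
    have "L = (2 * of_int (2 ^ n - 1) + 1) * h" "- L = (2 * of_int (- (2 ^ n)) + 1) * h"
      using N by (simp_all add: h_def n field_simps)
    then show "midrise h L = L" "midrise h (- L) = - L"
      using midrise_odd_multiple[of h] h by (metis less_numeral_extra(3))+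
  qed
  define g where "g x = ennreal \<bar>clip b x - clip b (quantize Q L x)\<bar>" for x
  have [measurable]: "g \<in> borel_measurable borel"
    unfolding g_def clip_def by measurable
  have "box_area Q L a b = (\<integral>\<^sup>+x. g x * indicator {-a..a} x \<partial>lborel)"
    unfolding box_area_def
  proof (rule nn_integral_cong)
    fix x :: real
    have "(\<integral>\<^sup>+t. indicator {\<bar>x\<bar>..} a * indicator {\<bar>t\<bar>..} b * indicator (sign_error Q L) (x, t) \<partial>lborel)
      = (\<integral>\<^sup>+t. indicator {-a..a} x * indicator {t. \<bar>t\<bar> \<le> b \<and> sign (x - t) \<noteq> sign (quantize Q L x - t)} t \<partial>lborel)"
      by (intro nn_integral_cong) (auto simp: sign_error_def split: split_indicator)
    also have "\<dots> = g x * indicator {-a..a} x"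
      by (subst nn_integral_cmult) (auto simp: g_def emeasure_sign_change[OF ab(2)] mult.commute)
    finally show "(\<integral>\<^sup>+t. indicator {\<bar>x\<bar>..} a * indicator {\<bar>t\<bar>..} b * indicator (sign_error Q L) (x, t) \<partial>lborel)
      = g x * indicator {-a..a} x" .
  qed
  also have "\<dots> = 2 * (\<integral>\<^sup>+x. g x * indicator {0..a} x \<partial>lborel)"
  proof (rule nn_integral_symmetric)
    have odd: "clip c (- x) = - clip c x" if "0 \<le> c" for c x
      using that by (auto simp: clip_def)
    show "AE x in lborel. g (- x) = g x"
      using AE_midrise_minus[OF h]
    proof eventually_elim
      case (elim x)
      \<comment> \<open>Almost-everywhere oddness serves only where clipping is inactive; outside,
        the clipped values are \<open>L\<close> and \<open>-L\<close>, which are levels and so fixed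
        by \<open>midrise h\<close>.\<close>
      have "midrise h (clip L (- x)) = - midrise h (clip L x)"
      proof (cases "\<bar>x\<bar> \<le> L")
        case True
        then have "clip L x = x" "clip L (- x) = - x" by (auto simp: clip_def)
        then show ?thesis using elim by simp
      next
        case False
        then have "clip L x = L \<and> clip L (- x) = - L \<or> clip L x = - L \<and> clip L (- x) = L"
          using L by (auto simp: clip_def)
        then show ?thesis using midL by auto
      qed
      then show ?case using odd[OF ab(2)] by (simp add: g_def q)
    qed
  qed measurable
  also have "(\<integral>\<^sup>+x. g x * indicator {0..a} x \<partial>lborel) =
      (\<integral>\<^sup>+x. ennreal (trunc_err h (min b L) x) * indicator {0..min a L} x
        + ennreal \<bar>min x b - min L b\<bar> * indicator {L<..a} x \<partial>lborel)"
  proof (rule nn_integral_cong)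
    fix x :: real
    consider "x < 0" | "0 \<le> x" "x \<le> L" | "L < x" by linarith
    then show "g x * indicator {0..a} x = ennreal (trunc_err h (min b L) x) * indicator {0..min a L} x
        + ennreal \<bar>min x b - min L b\<bar> * indicator {L<..a} x"
    proof cases
      case 1
      then show ?thesis using L by (auto split: split_indicator)
    next
      case 2
      have "midrise h x \<le> L" using midrise_mono[OF h 2(2)] midL by simp
      moreover have "0 \<le> midrise h x" using midrise_ge[OF h 2(1)] h by simp
      \<comment> \<open>Both \<open>x\<close> and its level are at most \<open>L\<close>, so
        truncating at \<open>b\<close> or at \<open>min b L\<close> is the same.\<close>
      moreover have "min y (min b L) = min b y" if "y \<le> L" for y
        using that by auto
      ultimately have "\<bar>clip b x - clip b (quantize Q L x)\<bar> = trunc_err h (min b L) x"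
        using 2 ab by (simp add: q clip_def trunc_err_def)
      then show ?thesis using 2 by (auto simp: g_def split: split_indicator)
    next
      case 3
      then have "clip L x = L" using L by (auto simp: clip_def)
      then have "\<bar>clip b x - clip b (quantize Q L x)\<bar> = \<bar>min x b - min L b\<bar>"
        using 3 ab L midL by (auto simp: q clip_def)
      then show ?thesis using 3 L by (auto simp: g_def split: split_indicator)
    qed
  qed
  also have "\<dots> = (\<integral>\<^sup>+x. ennreal (trunc_err h (min b L) x) * indicator {0..min a L} x \<partial>lborel) +
      (\<integral>\<^sup>+x. ennreal \<bar>min x b - min L b\<bar> * indicator {L<..a} x \<partial>lborel)"
    by (intro nn_integral_add) measurable
  also have "(\<integral>\<^sup>+x. ennreal (trunc_err h (min b L) x) * indicator {0..min a L} x \<partial>lborel) =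
      ennreal (integral {0..min a L} (trunc_err h (min b L)))"
  proof -
    have "(\<integral>\<^sup>+x. ennreal (trunc_err h (min b L) x) * indicator {0..min a L} x \<partial>lborel) =
      (\<integral>\<^sup>+x. ennreal (indicator {0..min a L} x *\<^sub>R trunc_err h (min b L) x) \<partial>lborel)"
      by (intro nn_integral_cong) (auto split: split_indicator)
    also have "\<dots> = ennreal (LINT x:{0..min a L}|lborel. trunc_err h (min b L) x)"
      unfolding set_lebesgue_integral_def
      using trunc_err_integrable[OF h, of 0 "min a L" "min b L"]
      by (intro nn_integral_eq_integral) (auto simp: set_integrable_def trunc_err_nonneg)
    also have "\<dots> = ennreal (integral {0..min a L} (trunc_err h (min b L)))"
      using set_borel_integral_eq_integral(2)[OF trunc_err_integrable[OF h]] by simp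
    finally show ?thesis .
  qed
  finally show ?thesis by (simp add: h_def)
qed

text \<open>Only the staircase term depends on \<open>Q\<close>, and refinement does not increase
  it. Boxes containing \<open>[-L, L]^2\<close> gain a fixed positive amount, the source of strict
  inequality.\<close>

lemma box_area_Suc:
  assumes L: "L > 0" and Q: "1 \<le> Q"
  shows "box_area (Suc Q) L a b + ennreal ((L / (2 ^ Q - 1))\<^sup>2 / 32) * indicator {\<bar>L\<bar>..} a * indicator {\<bar>L\<bar>..} b
    \<le> box_area Q L a b"
proof (cases "0 \<le> a \<and> 0 \<le> b")
  case False
  then have "box_area (Suc Q) L a b = (\<integral>\<^sup>+x. \<integral>\<^sup>+t. 0 \<partial>lborel \<partial>(lborel :: real measure))"
    unfolding box_area_def
    by (intro nn_integral_cong) (auto split: split_indicator)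
  then show ?thesis using False L by (auto split: split_indicator)
next
  case True
  define h h' where "h = L / (2 ^ Q - 1)" and "h' = L / (2 ^ Suc Q - 1)"
  have "(2::real) ^ 1 \<le> 2 ^ Q" using Q by (intro power_increasing) auto
  then have N: "(2::real) ^ Q \<ge> 2" by simp
  \<comment> \<open>The ratio \<open>h / h'\<close> is \<open>2 + 1 / (2 ^ Q - 1)\<close>, which
    equals 3 for \<open>Q = 1\<close> and tends to 2.\<close>
  have h: "h > 0" "h / 3 \<le> h'" "h' \<le> h / 2" "0 < h'" "h \<le> L"
    using L N by (auto simp: h_def h'_def field_simps)
  define a' b' where "a' = min a L" and "b' = min b L"
  have ab': "0 \<le> a'" "0 \<le> b'" using True L by (auto simp: a'_def b'_def)
  define U where "U h = integral {0..a'} (trunc_err h b')" for h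
  define C where "C = (\<integral>\<^sup>+x. ennreal \<bar>min x b - min L b\<bar> * indicator {L<..a} x \<partial>lborel)"
  have eq: "box_area Q L a b = 2 * (ennreal (U h) + C)" "box_area (Suc Q) L a b = 2 * (ennreal (U h') + C)"
    using box_area_eq[OF L, of _ a b] Q True unfolding U_def C_def a'_def b'_def h_def h'_def by auto
  have U0: "0 \<le> U h'" unfolding U_def
    by (intro integral_nonneg trunc_err_integrable_on h trunc_err_nonneg)
  have "U h' + (if L \<le> a \<and> L \<le> b then h\<^sup>2 / 64 else 0) \<le> U h"
  proof (cases "L \<le> a \<and> L \<le> b")
    case True
    then have "min a' b' = L" by (simp add: a'_def b'_def)
    \<comment> \<open>The right side is \<open>3 * h^2 / 32\<close>; \<open>1 / 64\<close> is just a
      convenient smaller constant, doubled to \<open>1 / 32\<close> by the symmetry factor.\<close>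
    have "h\<^sup>2 / 64 \<le> h * (h / 4 - 5 * h / 32)" using h(1) by (simp add: power2_eq_square)
    also have "\<dots> \<le> h * (L / 4 - 5 * h / 32)" using h by (intro mult_left_mono) auto
    also have "\<dots> \<le> U h - U h'"
      using integral_trunc_err_refine_gap[OF h(1,4,3) ab'] unfolding \<open>min a' b' = L\<close> U_def by linarith
    finally show ?thesis using True by simp
  next
    case False
    then show ?thesis using integral_trunc_err_refine[OF h(1-3) ab'] by (auto simp: U_def)
  qed
  then have "2 * (ennreal (U h' + (if L \<le> a \<and> L \<le> b then h\<^sup>2 / 64 else 0)) + C) \<le> box_area Q L a b"
    unfolding eq by (intro mult_left_mono add_right_mono ennreal_leI) auto
  moreover have "ennreal (h\<^sup>2 / 32) = 2 * ennreal (h\<^sup>2 / 64)"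
    using ennreal_mult[of 2 "h\<^sup>2 / 64"] by simp
  ultimately show ?thesis unfolding eq using U0 L
    by (auto simp: h_def[symmetric] ennreal_plus distrib_left ac_simps split: split_indicator if_splits)
qed

section \<open>Gaussian mixtures, Tonelli and the error probability\<close>

text \<open>The weight is minus the derivative of the density, which vanishes at infinity;
  integrating from \<open>|x|\<close> recovers the density by evenness.\<close>

lemma normal_density_layer_cake:
  assumes "\<sigma> > 0"
  shows "ennreal (normal_density 0 \<sigma> x) =
    (\<integral>\<^sup>+a. ennreal (a / \<sigma>\<^sup>2 * normal_density 0 \<sigma> a) * indicator {\<bar>x\<bar>..} a \<partial>lborel)"
proof -
  have "(\<integral>\<^sup>+a. ennreal (a / \<sigma>\<^sup>2 * normal_density 0 \<sigma> a) * indicator {\<bar>x\<bar>..} a \<partial>lborel)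
    = ennreal (0 - (- normal_density 0 \<sigma> \<bar>x\<bar>))"
  proof (rule nn_integral_FTC_atLeast)
    show "((\<lambda>a. - normal_density 0 \<sigma> a) has_real_derivative a / \<sigma>\<^sup>2 * normal_density 0 \<sigma> a) (at a)" for a
      unfolding normal_density_def using assms
      by (auto intro!: derivative_eq_intros simp: field_simps power2_eq_square)
    show "((\<lambda>a. - normal_density 0 \<sigma> a) \<longlongrightarrow> 0) at_top"
      unfolding normal_density_def using assms by real_asymp
  qed (use assms in auto)
  also have "normal_density 0 \<sigma> \<bar>x\<bar> = normal_density 0 \<sigma> x" by (simp add: normal_density_def)
  finally show ?thesis by simp
qed

lemma nn_integral_layer_cake_pair:
  fixes I J e :: "real \<Rightarrow> real \<Rightarrow> ennreal" and k l :: "real \<Rightarrow> ennreal"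
  assumes [measurable]: "case_prod I \<in> borel_measurable (borel \<Otimes>\<^sub>M borel)"
    "case_prod J \<in> borel_measurable (borel \<Otimes>\<^sub>M borel)"
    "case_prod e \<in> borel_measurable (borel \<Otimes>\<^sub>M borel)"
    "k \<in> borel_measurable borel" "l \<in> borel_measurable borel"
  shows "(\<integral>\<^sup>+x. \<integral>\<^sup>+t. (\<integral>\<^sup>+a. k a * I x a \<partial>lborel) * (\<integral>\<^sup>+b. l b * J t b \<partial>lborel) * e x t \<partial>lborel \<partial>lborel)
    = (\<integral>\<^sup>+a. \<integral>\<^sup>+b. k a * l b * (\<integral>\<^sup>+x. \<integral>\<^sup>+t. I x a * J t b * e x t \<partial>lborel \<partial>lborel) \<partial>lborel \<partial>lborel)"
proof -
  let ?F = "\<lambda>x t a b. k a * l b * (I x a * J t b * e x t)"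
  have "(\<integral>\<^sup>+x. \<integral>\<^sup>+t. (\<integral>\<^sup>+a. k a * I x a \<partial>lborel) * (\<integral>\<^sup>+b. l b * J t b \<partial>lborel) * e x t \<partial>lborel \<partial>lborel)
    = (\<integral>\<^sup>+x. \<integral>\<^sup>+t. \<integral>\<^sup>+a. \<integral>\<^sup>+b. ?F x t a b \<partial>lborel \<partial>lborel \<partial>lborel \<partial>lborel)"
  proof (intro nn_integral_cong)
    fix x t :: real
    have "(\<integral>\<^sup>+a. \<integral>\<^sup>+b. ?F x t a b \<partial>lborel \<partial>lborel)
      = (\<integral>\<^sup>+a. (\<integral>\<^sup>+b. (k a * I x a) * ((l b * J t b) * e x t) \<partial>lborel) \<partial>lborel)"
      by (simp add: ac_simps)
    also have "\<dots> = (\<integral>\<^sup>+a. (k a * I x a) * ((\<integral>\<^sup>+b. l b * J t b \<partial>lborel) * e x t) \<partial>lborel)"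
      by (simp add: nn_integral_cmult nn_integral_multc)
    also have "\<dots> = (\<integral>\<^sup>+a. k a * I x a \<partial>lborel) * ((\<integral>\<^sup>+b. l b * J t b \<partial>lborel) * e x t)"
      by (rule nn_integral_multc) measurable
    finally show "(\<integral>\<^sup>+a. k a * I x a \<partial>lborel) * (\<integral>\<^sup>+b. l b * J t b \<partial>lborel) * e x t
      = (\<integral>\<^sup>+a. \<integral>\<^sup>+b. ?F x t a b \<partial>lborel \<partial>lborel)"
      by (simp add: mult.assoc)
  qed
  \<comment> \<open>Four swaps of adjacent integrals carry the order \<open>x, t, a, b\<close> to
    \<open>a, b, x, t\<close>.\<close>
  also have "\<dots> = (\<integral>\<^sup>+x. \<integral>\<^sup>+a. \<integral>\<^sup>+t. \<integral>\<^sup>+b. ?F x t a b \<partial>lborel \<partial>lborel \<partial>lborel \<partial>lborel)"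
    by (intro nn_integral_cong lborel_pair.Fubini') measurable
  also have "\<dots> = (\<integral>\<^sup>+a. \<integral>\<^sup>+x. \<integral>\<^sup>+t. \<integral>\<^sup>+b. ?F x t a b \<partial>lborel \<partial>lborel \<partial>lborel \<partial>lborel)"
    by (intro lborel_pair.Fubini') measurable
  also have "\<dots> = (\<integral>\<^sup>+a. \<integral>\<^sup>+x. \<integral>\<^sup>+b. \<integral>\<^sup>+t. ?F x t a b \<partial>lborel \<partial>lborel \<partial>lborel \<partial>lborel)"
    by (intro nn_integral_cong lborel_pair.Fubini') measurable
  also have "\<dots> = (\<integral>\<^sup>+a. \<integral>\<^sup>+b. \<integral>\<^sup>+x. \<integral>\<^sup>+t. ?F x t a b \<partial>lborel \<partial>lborel \<partial>lborel \<partial>lborel)"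
    by (intro nn_integral_cong lborel_pair.Fubini') measurable
  also have "\<dots> = (\<integral>\<^sup>+a. \<integral>\<^sup>+b. k a * l b * (\<integral>\<^sup>+x. \<integral>\<^sup>+t. I x a * J t b * e x t \<partial>lborel \<partial>lborel) \<partial>lborel \<partial>lborel)"
    by (simp add: nn_integral_cmult)
  finally show ?thesis .
qed


text \<open>Independence makes the joint density a product; writing each factor as a mixture of
  interval indicators and exchanging integrals leaves the box areas.\<close>

lemma (in prob_space) p_error_eq_nn_integral:
  assumes s: "\<sigma>1 > 0" "\<sigma>2 > 0"
    and X: "distributed M lborel X (normal_density 0 \<sigma>1)"
    and Y: "distributed M lborel Y (normal_density 0 \<sigma>2)"
    and indep: "indep_var borel X borel Y"
  shows "ennreal (p_error M X Y L Q) =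
    (\<integral>\<^sup>+a. \<integral>\<^sup>+b. ennreal (a / \<sigma>1\<^sup>2 * normal_density 0 \<sigma>1 a) * ennreal (b / \<sigma>2\<^sup>2 * normal_density 0 \<sigma>2 b)
      * box_area Q L a b \<partial>lborel \<partial>lborel)"
proof -
  have "indep_var lborel X lborel Y"
    using indep unfolding indep_var_eq by simp
  then have XY: "distributed M (lborel \<Otimes>\<^sub>M lborel) (\<lambda>\<omega>. (X \<omega>, Y \<omega>))
      (\<lambda>(x, t). ennreal (normal_density 0 \<sigma>1 x) * ennreal (normal_density 0 \<sigma>2 t))"
    using X Y by (intro distributed_joint_indep lborel.sigma_finite_measure_axioms)
  have "{\<omega> \<in> space M. sign (X \<omega> - Y \<omega>) \<noteq> sign (quantize Q L (X \<omega>) - Y \<omega>)}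
      = (\<lambda>\<omega>. (X \<omega>, Y \<omega>)) -` sign_error Q L \<inter> space M"
    by (auto simp: sign_error_def)
  then have "ennreal (p_error M X Y L Q) = emeasure M ((\<lambda>\<omega>. (X \<omega>, Y \<omega>)) -` sign_error Q L \<inter> space M)"
    by (simp add: p_error_def emeasure_eq_measure)
  also have "\<dots> = (\<integral>\<^sup>+p. (case p of (x, t) \<Rightarrow> ennreal (normal_density 0 \<sigma>1 x) * ennreal (normal_density 0 \<sigma>2 t))
      * indicator (sign_error Q L) p \<partial>(lborel \<Otimes>\<^sub>M lborel))"
    by (rule distributed_emeasure[OF XY]) simp
  also have "\<dots> = (\<integral>\<^sup>+x. \<integral>\<^sup>+t. ennreal (normal_density 0 \<sigma>1 x) * ennreal (normal_density 0 \<sigma>2 t)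
      * indicator (sign_error Q L) (x, t) \<partial>lborel \<partial>lborel)"
    by (subst lborel.nn_integral_fst[symmetric]) (simp_all add: split_def)
  also have "\<dots> = (\<integral>\<^sup>+a. \<integral>\<^sup>+b. ennreal (a / \<sigma>1\<^sup>2 * normal_density 0 \<sigma>1 a) * ennreal (b / \<sigma>2\<^sup>2 * normal_density 0 \<sigma>2 b)
      * box_area Q L a b \<partial>lborel \<partial>lborel)"
    unfolding box_area_def
      normal_density_layer_cake[OF s(1)] normal_density_layer_cake[OF s(2)]
    by (rule nn_integral_layer_cake_pair) measurable
  finally show ?thesis .
qed

lemma (in prob_space) p_error_Suc_less:
  assumes s: "\<sigma>1 > 0" "\<sigma>2 > 0" and L: "L > 0"
    and X: "distributed M lborel X (normal_density 0 \<sigma>1)"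
    and Y: "distributed M lborel Y (normal_density 0 \<sigma>2)"
    and indep: "indep_var borel X borel Y" and Q: "1 \<le> Q"
  shows "p_error M X Y L (Suc Q) < p_error M X Y L Q"
proof -
  define k where "k a = ennreal (a / \<sigma>1\<^sup>2 * normal_density 0 \<sigma>1 a)" for a
  define l where "l b = ennreal (b / \<sigma>2\<^sup>2 * normal_density 0 \<sigma>2 b)" for b
  define \<delta> where "\<delta> = (L / (2 ^ Q - 1))\<^sup>2 / 32"
  \<comment> \<open>This is the gain \<open>\<delta>\<close> weighted by the mixture mass of all
    boxes with \<open>a \<ge> L\<close> and \<open>b \<ge> L\<close>. By the layer-cake formula at
    \<open>L\<close>, that mass is the product of the two densities at \<open>L\<close>.\<close>
  define \<epsilon> where "\<epsilon> = \<delta> * normal_density 0 \<sigma>1 L * normal_density 0 \<sigma>2 L"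
  have [measurable]: "k \<in> borel_measurable borel" "l \<in> borel_measurable borel"
    unfolding k_def l_def by measurable
  have [measurable]: "(\<lambda>(a, b). box_area Q L a b) \<in> borel_measurable (borel \<Otimes>\<^sub>M borel)" for Q L
    unfolding box_area_def by measurable
  have "(2::real) ^ Q - 1 > 0" using Q by simp
  then have d: "\<delta> > 0" using L by (simp add: \<delta>_def)
  have e: "\<epsilon> > 0" unfolding \<epsilon>_def using d s by (intro mult_pos_pos normal_density_pos)
  note p = p_error_eq_nn_integral[OF s X Y indep, of L, folded k_def l_def]
  have "ennreal (normal_density 0 \<sigma>1 L) = (\<integral>\<^sup>+a. k a * indicator {\<bar>L\<bar>..} a \<partial>lborel)"
    "ennreal (normal_density 0 \<sigma>2 L) = (\<integral>\<^sup>+b. l b * indicator {\<bar>L\<bar>..} b \<partial>lborel)"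
    using normal_density_layer_cake s unfolding k_def l_def by auto
  then have "ennreal \<epsilon> = ennreal \<delta> * (\<integral>\<^sup>+a. k a * indicator {\<bar>L\<bar>..} a \<partial>lborel) * (\<integral>\<^sup>+b. l b * indicator {\<bar>L\<bar>..} b \<partial>lborel)"
    using d by (simp add: \<epsilon>_def ennreal_mult)
  also have "\<dots> = (\<integral>\<^sup>+a. \<integral>\<^sup>+b. (ennreal \<delta> * (k a * indicator {\<bar>L\<bar>..} a)) * (l b * indicator {\<bar>L\<bar>..} b) \<partial>lborel \<partial>lborel)"
    by (simp add: nn_integral_cmult nn_integral_multc)
  finally have "ennreal (p_error M X Y L (Suc Q)) + ennreal \<epsilon> =
     (\<integral>\<^sup>+a. (\<integral>\<^sup>+b. k a * l b * box_area (Suc Q) L a b \<partial>lborel)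
       + (\<integral>\<^sup>+b. (ennreal \<delta> * (k a * indicator {\<bar>L\<bar>..} a)) * (l b * indicator {\<bar>L\<bar>..} b) \<partial>lborel) \<partial>lborel)"
    unfolding p by (simp add: nn_integral_add)
  also have "\<dots> = (\<integral>\<^sup>+a. \<integral>\<^sup>+b. k a * l b * box_area (Suc Q) L a b
       + (ennreal \<delta> * (k a * indicator {\<bar>L\<bar>..} a)) * (l b * indicator {\<bar>L\<bar>..} b) \<partial>lborel \<partial>lborel)"
    by (intro nn_integral_cong nn_integral_add[symmetric]) measurable
  also have "\<dots> = (\<integral>\<^sup>+a. \<integral>\<^sup>+b. k a * l b * (box_area (Suc Q) L a b
       + ennreal \<delta> * indicator {\<bar>L\<bar>..} a * indicator {\<bar>L\<bar>..} b) \<partial>lborel \<partial>lborel)"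
    by (simp add: distrib_left ac_simps)
  also have "\<dots> \<le> ennreal (p_error M X Y L Q)"
    unfolding p \<delta>_def using box_area_Suc[OF L Q]
    by (intro nn_integral_mono mult_left_mono) auto
  finally have "p_error M X Y L (Suc Q) + \<epsilon> \<le> p_error M X Y L Q"
    using e by (simp add: p_error_def flip: ennreal_plus)
  then show ?thesis using e by simp
qed

theorem theorem3:
  fixes M :: "'w measure" and X XT :: "'w \<Rightarrow> real" and \<sigma>1 \<sigma>2 L :: real
  assumes "prob_space M"
    and "\<sigma>1 > 0" and "\<sigma>2 > 0" and "L > 0"
    and "distributed M lborel X (normal_density 0 \<sigma>1)"
    and "distributed M lborel XT (normal_density 0 \<sigma>2)"
    and "prob_space.indep_var M borel X borel XT"
  shows "\<forall>Q1 \<in> {1..8}. \<forall>Q2 \<in> {1..8}. Q1 < Q2 \<longrightarrow>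
           p_error M X XT L Q2 < p_error M X XT L Q1"
proof (intro ballI impI)
  fix Q1 Q2 :: nat assume Q: "Q1 \<in> {1..8}" "Q1 < Q2"
  interpret prob_space M by fact
  have "p_error M X XT L Q < p_error M X XT L Q1" if "Suc Q1 \<le> Q" for Q
    using that
  proof (induction Q rule: dec_induct)
    case base
    show ?case using p_error_Suc_less[OF assms(2-7)] Q by simp
  next
    case (step n)
    have "p_error M X XT L (Suc n) < p_error M X XT L n"
      using p_error_Suc_less[OF assms(2-7)] step by simp
    with step.IH show ?case by simp
  qed
  then show "p_error M X XT L Q2 < p_error M X XT L Q1" using Q by simp
qed

end
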